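(* The Hardy inequality and the Hilbert inequality are equivalent; that is, the following are equivalent: (i) (Hardy inequality) there is a constant $A$ such that for every $f(z)=\sum_{n=0}^{\infty} a_n z^n$ in $H^1$, $$\sum_{n=0}^{\infty} \frac{|a_n|}{n+1} \le A\, \|f\|_1 ;$$ (ii) (Hilbert inequality) there is a constant $B$ such that for all $(a_n), (b_n)$ in $\ell^2_+$, $$\sum_{m,n=0}^{\infty} \frac{|a_n|\,|b_m|}{n+m+1} \le B\, \|(a_n)\|_2\, \|(b_n)\|_2 .$$
   Context: $H^1$ is the Hardy space of holomorphic functions $f$ on the open unit disk $\mathbb{D}$ with $$\|f\|_1=\sup_{0<r<1} \frac{1}{2\pi}\int_0^{2\pi} |f(re^{i\theta})|\, d\theta<\infty .$$ $\ell^2_+$ is the Hilbert space of square-summable complex sequences indexed by the integers $n\ge 0$, with norm $\|(a_n)\|_2=\left(\sum_{n\ge 0}|a_n|^2\right)^{1/2}$. *)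

theory Defs
  imports "HOL-Complex_Analysis.Complex_Analysis"
begin

definition circle_mean :: "(complex \<Rightarrow> complex) \<Rightarrow> real \<Rightarrow> real" where
  "circle_mean f r =
     1 / (2 * pi) * integral {0..2 * pi} (\<lambda>t. norm (f (of_real r * exp (\<i> * of_real t))))"

definition hardy_H1 :: "(complex \<Rightarrow> complex) set" where
  "hardy_H1 = {f. f holomorphic_on ball 0 1 \<and> bdd_above (circle_mean f ` {0<..<1})}"

text \<open>The real supremum below is meaningful only for members of \<open>hardy_H1\<close>,
  where the circle means are bounded.\<close>

definition hardy_norm1 :: "(complex \<Rightarrow> complex) \<Rightarrow> real" where
  "hardy_norm1 f = (SUP r\<in>{0<..<1}. circle_mean f r)"

definition ell2 :: "(nat \<Rightarrow> complex) set" where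
  "ell2 = {a. summable (\<lambda>n. (norm (a n))\<^sup>2)}"

definition ell2_norm :: "(nat \<Rightarrow> complex) \<Rightarrow> real" where
  "ell2_norm a = sqrt (\<Sum>n. (norm (a n))\<^sup>2)"

text \<open>In both inequalities the convergence of the left-hand side is part of the assertion;
  it is stated separately because sums of divergent real families default to junk values.\<close>

definition hardy_inequality :: bool where
  "hardy_inequality \<longleftrightarrow>
     (\<exists>A::real. \<forall>f\<in>hardy_H1. \<forall>a::nat \<Rightarrow> complex.
        (\<forall>z\<in>ball 0 1. (\<lambda>n. a n * z ^ n) sums f z) \<longrightarrow>
          summable (\<lambda>n. norm (a n) / (real n + 1)) \<and>
          (\<Sum>n. norm (a n) / (real n + 1)) \<le> A * hardy_norm1 f)"

definition hilbert_inequality :: bool where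
  "hilbert_inequality \<longleftrightarrow>
     (\<exists>B::real. \<forall>a\<in>ell2. \<forall>b\<in>ell2.
        (\<lambda>(m, n). norm (a n) * norm (b m) / (real n + real m + 1)) summable_on UNIV \<and>
        (\<Sum>\<^sub>\<infinity>(m, n)\<in>UNIV. norm (a n) * norm (b m) / (real n + real m + 1))
          \<le> B * ell2_norm a * ell2_norm b)"

end

theory Submission
  imports Defs "HOL-Computational_Algebra.Fundamental_Theorem_Algebra"
begin

text \<open>
  The kernel \<open>1 / (n + m + 1)\<close> depends on \<open>n + m\<close> only. Summing the Hilbert double series of two
  nonnegative sequences along antidiagonals therefore gives the Hardy series of their Cauchy
  product, that is, of the coefficients of the product of the two power series
  (\<open>hilbert_sum_triangle\<close>). So the equivalence expresses that products of two functions with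
  square-summable coefficients are the same thing as functions in $H^1$, with matching norms.

  From Hardy to Hilbert this is the easy inclusion: by Parseval's identity (\<open>parseval\<close>) and the
  Cauchy-Schwarz inequality on each circle, the product of the power series with coefficients
  \<open>norm (a n)\<close> and \<open>norm (b n)\<close> has $H^1$ norm at most \<open>ell2_norm a * ell2_norm b\<close>. Its
  coefficients are nonnegative, so nothing cancels and Hardy's inequality bounds the whole double
  sum.

  From Hilbert to Hardy a function must be factored into two square-summable power series without
  loss of norm. It suffices to do this for polynomials, because on a circle of radius \<open>r < 1\<close> a
  member of $H^1$ is uniformly approximated by its Taylor polynomials. Replacing each zero \<open>w\<close> of a
  polynomial \<open>p\<close> inside the disc by its mirror image in the unit circle yields a polynomial \<open>q\<close>
  without zeros in the disc that dominates \<open>p\<close> there and has the same modulus on the unit circle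
  (\<open>poly_reflect_zeros\<close>). The quotient \<open>p / q\<close> is a finite Blaschke product. Now \<open>q\<close> has
  a holomorphic square root \<open>G\<close> in the disc, and \<open>p = G * H\<close> with \<open>H = p / G\<close>. The squares of both
  factors are dominated in modulus by \<open>q\<close> in the disc, so the coefficients of each have squared
  \<open>ell2\<close> norm at most the mean of \<open>q\<close>, hence of \<open>p\<close>, over the unit circle
  (\<open>coeffs_ell2_of_square_le_poly\<close>).
\<close>

section \<open>Circle means\<close>

lemma continuous_on_circle:
  assumes "continuous_on (sphere 0 r) f" "0 \<le> r"
  shows "continuous_on S (\<lambda>t. f (of_real r * exp (\<i> * of_real t)))"
proof (rule continuous_on_compose2[OF assms(1)])
  show "continuous_on S (\<lambda>t. of_real r * exp (\<i> * of_real t) :: complex)"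
    by (intro continuous_intros)
qed (use assms(2) in \<open>auto simp: norm_mult\<close>)

lemma circle_mean_nonneg: "0 \<le> circle_mean f r"
  unfolding circle_mean_def
  by (cases "(\<lambda>t. norm (f (of_real r * exp (\<i> * of_real t)))) integrable_on {0..2 * pi}")
    (auto intro!: divide_nonneg_nonneg integral_nonneg simp: not_integrable_integral)

lemma circle_mean_cong:
  assumes "\<And>z. z \<in> sphere 0 r \<Longrightarrow> norm (f z) = norm (g z)" "0 \<le> r"
  shows "circle_mean f r = circle_mean g r"
  unfolding circle_mean_def
  by (intro arg_cong2[of _ _ _ _ "(*)"] integral_cong assms(1) refl) (use assms(2) in \<open>auto simp: norm_mult\<close>)

text \<open>The one comparison principle for circle means that the argument needs: it covers
  monotonicity, the weighted arithmetic-geometric inequality for a product, and, with a constant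
  \<open>h\<close>, a uniform approximation error.\<close>

lemma circle_mean_le_combination:
  assumes "continuous_on (sphere 0 r) f" "continuous_on (sphere 0 r) g" "continuous_on (sphere 0 r) h"
    and "0 \<le> r"
    and le: "\<And>z. z \<in> sphere 0 r \<Longrightarrow> norm (f z) \<le> \<alpha> * norm (g z) + \<beta> * norm (h z)"
  shows "circle_mean f r \<le> \<alpha> * circle_mean g r + \<beta> * circle_mean h r"
proof -
  let ?c = "\<lambda>t. of_real r * exp (\<i> * of_real t) :: complex"
  let ?I = "\<lambda>f. integral {0..2 * pi} (\<lambda>t. norm (f (?c t)))"
  have int: "(\<lambda>t. norm (u (?c t))) integrable_on {0..2 * pi}" if "continuous_on (sphere 0 r) u"
    for u :: "complex \<Rightarrow> complex"
    by (intro integrable_continuous_real continuous_on_norm continuous_on_circle that assms(4))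
  have "?I f \<le> integral {0..2 * pi} (\<lambda>t. \<alpha> * norm (g (?c t)) + \<beta> * norm (h (?c t)))"
    by (intro integral_le integrable_add integrable_on_mult_right int assms(1-3) le)
      (use assms(4) in \<open>auto simp: norm_mult\<close>)
  also have "\<dots> = integral {0..2 * pi} (\<lambda>t. \<alpha> * norm (g (?c t)))
      + integral {0..2 * pi} (\<lambda>t. \<beta> * norm (h (?c t)))"
    by (intro integral_add integrable_on_mult_right int assms(2,3))
  also have "\<dots> = \<alpha> * ?I g + \<beta> * ?I h"
    by simp
  finally have "1 / (2 * pi) * ?I f \<le> 1 / (2 * pi) * (\<alpha> * ?I g + \<beta> * ?I h)"
    by (intro mult_left_mono) auto
  then show ?thesis
    by (simp add: circle_mean_def algebra_simps)
qed

lemma circle_mean_one: "circle_mean (\<lambda>_. 1) r = 1"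
  by (simp add: circle_mean_def)

lemma circle_mean_mono:
  assumes "continuous_on (sphere 0 r) f" "continuous_on (sphere 0 r) g" "0 \<le> r"
    and "\<And>z. z \<in> sphere 0 r \<Longrightarrow> norm (f z) \<le> norm (g z)"
  shows "circle_mean f r \<le> circle_mean g r"
  using circle_mean_le_combination[of r f g g 1 0] assms by simp

text \<open>The Cauchy-Schwarz inequality in linearised form; optimising over the weight \<open>s\<close> recovers
  it.\<close>

lemma circle_mean_mult_le:
  assumes "continuous_on (sphere 0 r) f" "continuous_on (sphere 0 r) g" "0 \<le> r" "0 < s"
  shows "circle_mean (\<lambda>z. f z * g z) r
     \<le> s / 2 * circle_mean (\<lambda>z. (f z)\<^sup>2) r + 1 / (2 * s) * circle_mean (\<lambda>z. (g z)\<^sup>2) r"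
proof (rule circle_mean_le_combination)
  fix z
  have "0 \<le> (s * norm (f z) - norm (g z))\<^sup>2 / (2 * s)"
    using assms(4) by simp
  also have "\<dots> = s / 2 * norm ((f z)\<^sup>2) + 1 / (2 * s) * norm ((g z)\<^sup>2) - norm (f z * g z)"
    using assms(4) by (simp add: norm_power norm_mult field_simps power2_eq_square)
  finally show "norm (f z * g z) \<le> s / 2 * norm ((f z)\<^sup>2) + 1 / (2 * s) * norm ((g z)\<^sup>2)"
    by simp
qed (use assms in \<open>auto intro!: continuous_intros\<close>)

text \<open>Allows bounds inside the disc to be carried to the unit circle itself.\<close>

lemma circle_mean_tendsto:
  assumes "continuous_on UNIV f"
  shows "(circle_mean f \<longlongrightarrow> circle_mean f 1) (at_left 1)"
proof -
  have "continuous_on UNIV (\<lambda>r. integral (cbox 0 (2 * pi)) (\<lambda>t. norm (f (of_real r * exp (\<i> * of_real t)))))"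
    by (rule integral_continuous_on_param)
      (auto simp: case_prod_beta intro!: continuous_intros continuous_on_compose2[OF assms])
  then have "continuous_on UNIV (circle_mean f)"
    unfolding circle_mean_def by (auto intro!: continuous_intros)
  then show ?thesis
    by (metis continuous_on_eq_continuous_at isContD UNIV_I open_UNIV tendsto_within_subset
        subset_UNIV)
qed

section \<open>Parseval's identity\<close>

text \<open>Orthogonality of the trigonometric monomials.\<close>

lemma has_integral_exp_int:
  "((\<lambda>t. exp (\<i> * of_int k * of_real t)) has_integral (if k = 0 then of_real (2 * pi) else 0)) {0..2 * pi}"
proof (cases "k = 0")
  case True
  then show ?thesis
    using has_integral_const_real[of "1::complex" 0 "2 * pi"] by (simp add: scaleR_conv_of_real)
next
  case False
  let ?F = "\<lambda>t. exp (\<i> * of_int k * of_real t) / (\<i> * of_int k)"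
  have "((\<lambda>t. exp (\<i> * of_int k * of_real t)) has_integral (?F (2 * pi) - ?F 0)) {0..2 * pi}"
  proof (rule fundamental_theorem_of_calculus)
    fix t
    have "((\<lambda>z. exp (\<i> * of_int k * z) / (\<i> * of_int k)) has_field_derivative
        exp (\<i> * of_int k * of_real t)) (at (of_real t))"
      using False by (auto intro!: derivative_eq_intros)
    then show "(?F has_vector_derivative exp (\<i> * of_int k * of_real t)) (at t within {0..2 * pi})"
      by (rule has_vector_derivative_real_field)
  qed simp
  moreover have "exp (\<i> * of_int k * of_real (2 * pi)) = 1"
    using exp_integer_2pi[of "of_int k"] by (simp add: mult_ac)
  ultimately show ?thesis
    using False by simp
qed

lemma trig_poly_norm_square_integral:
  fixes c :: "nat \<Rightarrow> complex"
  shows "((\<lambda>t. (norm (\<Sum>n<N. c n * exp (\<i> * of_real t) ^ n))\<^sup>2)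
           has_integral 2 * pi * (\<Sum>n<N. (norm (c n))\<^sup>2)) {0..2 * pi}"
proof -
  let ?e = "\<lambda>k t. exp (\<i> * of_int k * of_real t)"
  have "((\<lambda>t. \<Sum>n<N. \<Sum>m<N. c n * cnj (c m) * ?e (int n - int m) t)
      has_integral (\<Sum>n<N. \<Sum>m<N. c n * cnj (c m) *
        (if int n - int m = 0 then of_real (2 * pi) else 0))) {0..2 * pi}"
    by (intro has_integral_sum has_integral_mult_right has_integral_exp_int finite_lessThan)
  also have "(\<lambda>t. \<Sum>n<N. \<Sum>m<N. c n * cnj (c m) * ?e (int n - int m) t)
      = (\<lambda>t. of_real ((norm (\<Sum>n<N. c n * exp (\<i> * of_real t) ^ n))\<^sup>2))"
  proof
    fix t
    \<comment> \<open>Negative frequencies arise from conjugating the second factor.\<close>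
    have e: "?e (int n - int m) t = exp (\<i> * of_real t) ^ n * cnj (exp (\<i> * of_real t) ^ m)" for n m
      by (simp add: exp_of_nat_mult[symmetric] exp_cnj exp_add[symmetric] algebra_simps)
    show "(\<Sum>n<N. \<Sum>m<N. c n * cnj (c m) * ?e (int n - int m) t)
      = of_real ((norm (\<Sum>n<N. c n * exp (\<i> * of_real t) ^ n))\<^sup>2)"
      unfolding e complex_norm_square cnj_sum sum_product
      by (intro sum.cong refl) simp
  qed
  also have "(\<Sum>n<N. \<Sum>m<N. c n * cnj (c m) * (if int n - int m = 0 then of_real (2 * pi) else 0))
      = of_real (2 * pi * (\<Sum>n<N. (norm (c n))\<^sup>2))"
  proof -
    have "(\<Sum>n<N. \<Sum>m<N. c n * cnj (c m) * (if int n - int m = 0 then of_real (2 * pi) else 0))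
       = (\<Sum>n<N. \<Sum>m<N. if n = m then of_real ((norm (c n))\<^sup>2) * of_real (2 * pi) else 0)"
      by (intro sum.cong refl) (auto simp: complex_norm_square simp del: of_real_power)
    then show ?thesis
      by (simp add: sum_distrib_left mult_ac)
  qed
  finally have "((\<lambda>t. of_real ((norm (\<Sum>n<N. c n * exp (\<i> * of_real t) ^ n))\<^sup>2) :: complex)
      has_integral of_real (2 * pi * (\<Sum>n<N. (norm (c n))\<^sup>2))) {0..2 * pi}" .
  from has_integral_Re[OF this] show ?thesis by simp
qed

lemma summable_norm_power_series:
  fixes a :: "nat \<Rightarrow> complex"
  assumes "\<And>z. z \<in> ball 0 1 \<Longrightarrow> (\<lambda>n. a n * z ^ n) sums f z" "norm z < 1"
  shows "summable (\<lambda>n. norm (a n * z ^ n))"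
proof (rule powser_insidea)
  let ?x = "of_real ((1 + norm z) / 2) :: complex"
  have x: "norm ?x = (1 + norm z) / 2"
    unfolding norm_of_real by simp
  show "summable (\<lambda>n. a n * ?x ^ n)"
    by (rule sums_summable[OF assms(1)]) (use assms(2) x in \<open>simp only: mem_ball_0\<close>, simp)
  show "norm z < norm ?x"
    unfolding x using assms(2) by simp
qed

lemma power_series_continuous_on_sphere:
  fixes f :: "complex \<Rightarrow> complex"
  assumes "\<And>z. z \<in> ball 0 1 \<Longrightarrow> (\<lambda>n. a n * z ^ n) sums f z" "r < 1"
  shows "continuous_on (sphere 0 r) f"
proof -
  have "f holomorphic_on ball 0 1"
    by (rule power_series_holomorphic[of _ _ a]) (use assms(1) in simp)
  then show ?thesis
    by (rule continuous_on_subset[OF holomorphic_on_imp_continuous_on]) (use assms(2) in auto)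
qed

text \<open>The partial sums on the circle are trigonometric polynomials, for which the identity is
  orthogonality. As the power series converges absolutely on the circle, the partial sums are
  uniformly bounded, and dominated convergence gives the general case.\<close>

lemma parseval:
  fixes a :: "nat \<Rightarrow> complex"
  assumes sums: "\<And>z. z \<in> ball 0 1 \<Longrightarrow> (\<lambda>n. a n * z ^ n) sums f z" and r: "0 \<le> r" "r < 1"
  shows "(\<lambda>n. (norm (a n) * r ^ n)\<^sup>2) sums circle_mean (\<lambda>z. (f z)\<^sup>2) r"
proof -
  define c where "c n = a n * of_real r ^ n" for n
  let ?S = "\<lambda>N t. \<Sum>n<N. c n * exp (\<i> * of_real t) ^ n"
  let ?F = "\<lambda>t. f (of_real r * exp (\<i> * of_real t))"
  have c: "norm (c n) = norm (a n) * r ^ n" for n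
    using r by (simp add: c_def norm_mult norm_power)
  have summ: "summable (\<lambda>n. norm (c n))"
    unfolding c_def by (rule summable_norm_power_series[OF sums]) (use r in auto)
  have "(\<lambda>N. integral {0..2 * pi} (\<lambda>t. (norm (?S N t))\<^sup>2)) \<longlonglongrightarrow> integral {0..2 * pi} (\<lambda>t. (norm (?F t))\<^sup>2)"
  proof (rule dominated_convergence(2))
    show "(\<lambda>t. (norm (?S N t))\<^sup>2) integrable_on {0..2 * pi}" for N
      using trig_poly_norm_square_integral by blast
    show "(\<lambda>_. (\<Sum>n. norm (c n))\<^sup>2) integrable_on {0..2 * pi}"
      by (rule integrable_const_ivl)
    show "norm ((norm (?S N t))\<^sup>2) \<le> (\<Sum>n. norm (c n))\<^sup>2" for N t
    proof -
      have "norm (?S N t) \<le> (\<Sum>n<N. norm (c n))"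
        by (rule sum_norm_le) (simp add: norm_mult norm_power)
      also have "\<dots> \<le> (\<Sum>n. norm (c n))"
        by (rule sum_le_suminf[OF summ]) auto
      finally show ?thesis
        by (simp add: power_mono)
    qed
    show "(\<lambda>N. (norm (?S N t))\<^sup>2) \<longlonglongrightarrow> (norm (?F t))\<^sup>2" for t
    proof -
      have "(\<lambda>n. a n * (of_real r * exp (\<i> * of_real t)) ^ n) sums ?F t"
        by (rule sums) (use r in \<open>simp add: norm_mult\<close>)
      then have "(\<lambda>N. ?S N t) \<longlonglongrightarrow> ?F t"
        by (simp add: sums_def c_def power_mult_distrib mult_ac)
      then show ?thesis
        by (intro tendsto_intros)
    qed
  qed
  then have "(\<lambda>N. 1 / (2 * pi) * (2 * pi * (\<Sum>n<N. (norm (c n))\<^sup>2)))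
      \<longlonglongrightarrow> 1 / (2 * pi) * integral {0..2 * pi} (\<lambda>t. (norm (?F t))\<^sup>2)"
    unfolding integral_unique[OF trig_poly_norm_square_integral] by (intro tendsto_intros)
  then show ?thesis
    by (simp add: sums_def c circle_mean_def norm_power)
qed

text \<open>Parseval's identity for the zero function forces all differences of coefficients to vanish.\<close>

lemma power_series_coeffs_unique:
  fixes a b :: "nat \<Rightarrow> complex"
  assumes "\<And>z. z \<in> ball 0 1 \<Longrightarrow> (\<lambda>n. a n * z ^ n) sums f z"
    and "\<And>z. z \<in> ball 0 1 \<Longrightarrow> (\<lambda>n. b n * z ^ n) sums f z"
  shows "a = b"
proof
  fix n
  have "(\<lambda>n. (a n - b n) * z ^ n) sums 0" if "z \<in> ball 0 1" for z
    using sums_diff[OF assms(1)[OF that] assms(2)[OF that]] by (simp add: algebra_simps)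
  \<comment> \<open>Any radius strictly between zero and one would do.\<close>
  from parseval[OF this, of "1/2"]
  have s: "(\<lambda>n. (norm (a n - b n) * (1/2) ^ n)\<^sup>2) sums 0"
    by (simp add: circle_mean_def)
  then have "(norm (a n - b n) * (1/2) ^ n)\<^sup>2 = 0"
    using suminf_eq_zero_iff[OF sums_summable[OF s]] sums_unique[OF s] by simp
  then show "a n = b n" by simp
qed

lemma ell2_norm_nonneg: "a \<in> ell2 \<Longrightarrow> 0 \<le> ell2_norm a"
  unfolding ell2_norm_def ell2_def by (simp add: suminf_nonneg)

lemma ell2_norm_square: "a \<in> ell2 \<Longrightarrow> (ell2_norm a)\<^sup>2 = (\<Sum>n. (norm (a n))\<^sup>2)"
  unfolding ell2_norm_def ell2_def by (simp add: suminf_nonneg)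

lemma circle_mean_square_le_ell2_norm:
  assumes "a \<in> ell2" "\<And>z. z \<in> ball 0 1 \<Longrightarrow> (\<lambda>n. a n * z ^ n) sums f z" "0 \<le> r" "r < 1"
  shows "circle_mean (\<lambda>z. (f z)\<^sup>2) r \<le> (ell2_norm a)\<^sup>2"
  unfolding ell2_norm_square[OF assms(1)]
proof (rule sums_le[OF _ parseval[OF assms(2-4)]])
  show "(\<lambda>n. (norm (a n))\<^sup>2) sums (\<Sum>n. (norm (a n))\<^sup>2)"
    using assms(1) by (simp add: ell2_def summable_sums)
  show "(norm (a n) * r ^ n)\<^sup>2 \<le> (norm (a n))\<^sup>2" for n
    using assms(3,4) by (intro power_mono mult_left_le) (auto intro: power_le_one)
qed

section \<open>The Cauchy product and the Hilbert double sum\<close>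

text \<open>The link between the two inequalities: on the antidiagonal \<open>n + m = k\<close> the kernel is the
  constant \<open>1 / (k + 1)\<close>, and what remains is a coefficient of the Cauchy product.\<close>

lemma hilbert_sum_triangle:
  fixes a b :: "nat \<Rightarrow> real"
  shows "(\<Sum>(n, m)\<in>{(n, m). n + m \<le> K}. a n * b m / (real n + real m + 1))
     = (\<Sum>k\<le>K. (\<Sum>i\<le>k. a i * b (k - i)) / (real k + 1))"
  unfolding sum.triangle_reindex_eq sum_divide_distrib
  by (intro sum.cong refl) (simp add: of_nat_diff)

lemma finite_triangle: "finite {(n, m). n + m \<le> (K::nat)}"
  by (rule finite_subset[of _ "{..K} \<times> {..K}"]) auto

text \<open>The best weight is \<open>\<beta> / \<alpha>\<close>. Shifting both numbers by a small \<open>e\<close> and letting it tend to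
  zero treats vanishing \<open>\<alpha>\<close> or \<open>\<beta>\<close> together with the generic case.\<close>

lemma le_mult_of_weighted_am_gm:
  fixes X \<alpha> \<beta> :: real
  assumes le: "\<And>s. 0 < s \<Longrightarrow> X \<le> s / 2 * \<alpha>\<^sup>2 + 1 / (2 * s) * \<beta>\<^sup>2" and "0 \<le> \<alpha>" "0 \<le> \<beta>"
  shows "X \<le> \<alpha> * \<beta>"
proof (rule tendsto_lowerbound)
  show "((\<lambda>e. (\<alpha> + e) * (\<beta> + e)) \<longlongrightarrow> \<alpha> * \<beta>) (at_right 0)"
    by (auto intro!: tendsto_eq_intros)
  have "X \<le> (\<alpha> + e) * (\<beta> + e)" if "0 < e" for e
  proof -
    have pos: "0 < \<alpha> + e" "0 < \<beta> + e" using assms that by auto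
    have "X \<le> (\<beta> + e) / (\<alpha> + e) / 2 * \<alpha>\<^sup>2 + 1 / (2 * ((\<beta> + e) / (\<alpha> + e))) * \<beta>\<^sup>2"
      by (rule le) (use pos in auto)
    also have "\<dots> \<le> (\<beta> + e) / (\<alpha> + e) / 2 * (\<alpha> + e)\<^sup>2 + 1 / (2 * ((\<beta> + e) / (\<alpha> + e))) * (\<beta> + e)\<^sup>2"
      using pos assms that by (intro add_mono mult_left_mono power_mono) auto
    also have "\<dots> = (\<alpha> + e) * (\<beta> + e)"
    proof -
      have "v / u / 2 * u\<^sup>2 + 1 / (2 * (v / u)) * v\<^sup>2 = u * v" if "0 < u" "0 < v" for u v :: real
        using that by (simp add: field_simps power2_eq_square)
      then show ?thesis using pos .
    qed
    finally show ?thesis .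
  qed
  then show "\<forall>\<^sub>F e in at_right 0. X \<le> (\<alpha> + e) * (\<beta> + e)"
    by (intro eventually_at_rightI[of 0 1]) auto
qed simp

section \<open>From Hardy to Hilbert\<close>

lemma ell2_power_series_summable:
  assumes "a \<in> ell2" "norm z < 1"
  shows "summable (\<lambda>n. norm (a n * z ^ n))"
proof (rule summable_comparison_test')
  have "(norm z)\<^sup>2 < 1"
    using assms(2) by (simp add: power_less_one_iff)
  then have "summable (\<lambda>n. ((norm z)\<^sup>2) ^ n)"
    by (intro summable_geometric) simp
  then show "summable (\<lambda>n. (norm (a n))\<^sup>2 + ((norm z)\<^sup>2) ^ n)"
    using assms(1) by (intro summable_add) (auto simp: ell2_def)
  fix n :: nat
  have "0 \<le> norm (a n) * norm z ^ n" by simp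
  moreover have "2 * norm (a n) * norm z ^ n \<le> (norm (a n))\<^sup>2 + (norm z ^ n)\<^sup>2"
    by (rule sum_squares_bound)
  moreover have "(norm z ^ n)\<^sup>2 = ((norm z)\<^sup>2) ^ n"
    by (simp only: power_mult[symmetric] mult.commute)
  ultimately show "norm (norm (a n * z ^ n)) \<le> (norm (a n))\<^sup>2 + ((norm z)\<^sup>2) ^ n"
    unfolding real_norm_def abs_norm_cancel norm_mult norm_power by linarith
qed

text \<open>Hardy's inequality is applied to the product of the power series with coefficients
  \<open>norm (a n)\<close> and \<open>norm (b n)\<close>. Passing to moduli leaves the \<open>ell2\<close> norms unchanged and
  makes every Cauchy product coefficient equal to its own modulus. The bound by \<open>\<bar>A\<bar>\<close>
  spares a discussion of the sign of \<open>A\<close>.\<close>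

lemma hardy_imp_hilbert_partial:
  assumes hardy: "\<forall>f\<in>hardy_H1. \<forall>a::nat \<Rightarrow> complex.
        (\<forall>z\<in>ball 0 1. (\<lambda>n. a n * z ^ n) sums f z) \<longrightarrow>
          summable (\<lambda>n. norm (a n) / (real n + 1)) \<and>
          (\<Sum>n. norm (a n) / (real n + 1)) \<le> A * hardy_norm1 f"
    and a: "a \<in> ell2" and b: "b \<in> ell2"
  shows "(\<Sum>(n, m)\<in>{(n, m). n + m \<le> K}. norm (a n) * norm (b m) / (real n + real m + 1))
     \<le> \<bar>A\<bar> * ell2_norm a * ell2_norm b"
proof -
  define \<alpha> \<beta> where "\<alpha> n = complex_of_real (norm (a n))" and "\<beta> n = complex_of_real (norm (b n))" for n
  define c where "c k = (\<Sum>i\<le>k. \<alpha> i * \<beta> (k - i))" for k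
  define f g where "f z = (\<Sum>n. \<alpha> n * z ^ n)" and "g z = (\<Sum>n. \<beta> n * z ^ n)" for z
  let ?h = "\<lambda>z. f z * g z"
  have [simp]: "norm (\<alpha> n) = norm (a n)" "norm (\<beta> n) = norm (b n)" for n
    by (simp_all add: \<alpha>_def \<beta>_def)
  have ell2: "\<alpha> \<in> ell2" "\<beta> \<in> ell2" "ell2_norm \<alpha> = ell2_norm a" "ell2_norm \<beta> = ell2_norm b"
    using a b by (simp_all add: ell2_def ell2_norm_def)
  have f: "(\<lambda>n. \<alpha> n * z ^ n) sums f z" and g: "(\<lambda>n. \<beta> n * z ^ n) sums g z" if "z \<in> ball 0 1" for z
    unfolding f_def g_def using that ell2(1,2)
    by (auto intro!: summable_sums summable_norm_cancel[OF ell2_power_series_summable])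
  have h: "(\<lambda>k. c k * z ^ k) sums ?h z" if "z \<in> ball 0 1" for z
  proof -
    have "(\<lambda>k. \<Sum>i\<le>k. \<alpha> i * z ^ i * (\<beta> (k - i) * z ^ (k - i))) sums ?h z"
      unfolding f_def g_def
      by (rule Cauchy_product_sums) (use that ell2 in \<open>auto intro!: ell2_power_series_summable\<close>)
    also have "(\<lambda>k. \<Sum>i\<le>k. \<alpha> i * z ^ i * (\<beta> (k - i) * z ^ (k - i))) = (\<lambda>k. c k * z ^ k)"
      unfolding c_def sum_distrib_right
      by (intro ext sum.cong refl) (simp add: mult_ac flip: power_add)
    finally show ?thesis .
  qed
  have mean: "circle_mean ?h r \<le> ell2_norm a * ell2_norm b" if r: "r \<in> {0<..<1}" for r
  proof (rule le_mult_of_weighted_am_gm)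
    fix s :: real assume s: "0 < s"
    have "circle_mean ?h r
        \<le> s / 2 * circle_mean (\<lambda>z. (f z)\<^sup>2) r + 1 / (2 * s) * circle_mean (\<lambda>z. (g z)\<^sup>2) r"
      by (rule circle_mean_mult_le)
        (use r s in \<open>auto intro: power_series_continuous_on_sphere[OF f] power_series_continuous_on_sphere[OF g]\<close>)
    also have "\<dots> \<le> s / 2 * (ell2_norm a)\<^sup>2 + 1 / (2 * s) * (ell2_norm b)\<^sup>2"
      using s r circle_mean_square_le_ell2_norm[OF ell2(1) f, of r]
        circle_mean_square_le_ell2_norm[OF ell2(2) g, of r] ell2(3,4)
      by (intro add_mono mult_left_mono) auto
    finally show "circle_mean ?h r \<le> s / 2 * (ell2_norm a)\<^sup>2 + 1 / (2 * s) * (ell2_norm b)\<^sup>2" .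
  qed (use a b in \<open>auto intro: ell2_norm_nonneg\<close>)
  have "?h holomorphic_on ball 0 1"
    by (rule power_series_holomorphic[of _ _ c]) (use h in simp)
  then have H1: "?h \<in> hardy_H1"
    unfolding hardy_H1_def using mean by (auto intro!: bdd_aboveI2[of _ _ "ell2_norm a * ell2_norm b"])
  have norm1: "\<bar>hardy_norm1 ?h\<bar> \<le> ell2_norm a * ell2_norm b"
  proof -
    have "hardy_norm1 ?h \<le> ell2_norm a * ell2_norm b"
      unfolding hardy_norm1_def by (rule cSUP_least) (use mean in auto)
    moreover have "circle_mean ?h (1/2) \<le> hardy_norm1 ?h"
      unfolding hardy_norm1_def by (rule cSUP_upper) (use H1 in \<open>auto simp: hardy_H1_def\<close>)
    ultimately show ?thesis
      using circle_mean_nonneg[of ?h "1/2"] by linarith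
  qed
  have hardy_h: "summable (\<lambda>k. norm (c k) / (real k + 1))"
      "(\<Sum>k. norm (c k) / (real k + 1)) \<le> A * hardy_norm1 ?h"
    using hardy[rule_format, OF H1 h] by simp_all
  have c: "norm (c k) = (\<Sum>i\<le>k. norm (a i) * norm (b (k - i)))" for k
  proof -
    have "c k = of_real (\<Sum>i\<le>k. norm (a i) * norm (b (k - i)))"
      by (simp add: c_def \<alpha>_def \<beta>_def)
    then show ?thesis
      by (simp only: norm_of_real) (simp add: sum_nonneg)
  qed
  have "(\<Sum>(n, m)\<in>{(n, m). n + m \<le> K}. norm (a n) * norm (b m) / (real n + real m + 1))
      = (\<Sum>k\<le>K. norm (c k) / (real k + 1))"
    by (simp only: hilbert_sum_triangle c)
  also have "\<dots> \<le> (\<Sum>k. norm (c k) / (real k + 1))"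
    by (rule sum_le_suminf[OF hardy_h(1)]) auto
  also have "\<dots> \<le> A * hardy_norm1 ?h"
    by (rule hardy_h(2))
  also have "\<dots> \<le> \<bar>A\<bar> * \<bar>hardy_norm1 ?h\<bar>"
    by (simp add: abs_mult[symmetric])
  also have "\<dots> \<le> \<bar>A\<bar> * (ell2_norm a * ell2_norm b)"
    by (intro mult_left_mono norm1) auto
  finally show ?thesis by (simp add: mult_ac)
qed

lemma hardy_imp_hilbert:
  assumes "hardy_inequality"
  shows "hilbert_inequality"
proof -
  from assms obtain A where A: "\<forall>f\<in>hardy_H1. \<forall>a::nat \<Rightarrow> complex.
        (\<forall>z\<in>ball 0 1. (\<lambda>n. a n * z ^ n) sums f z) \<longrightarrow>
          summable (\<lambda>n. norm (a n) / (real n + 1)) \<and>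
          (\<Sum>n. norm (a n) / (real n + 1)) \<le> A * hardy_norm1 f"
    unfolding hardy_inequality_def by blast
  show ?thesis
    unfolding hilbert_inequality_def
  proof (intro exI[of _ "\<bar>A\<bar>"] ballI)
    fix a b assume ab: "a \<in> ell2" "b \<in> ell2"
    let ?t = "\<lambda>(m, n). norm (a n) * norm (b m) / (real n + real m + 1)"
    have fin: "sum ?t F \<le> \<bar>A\<bar> * ell2_norm a * ell2_norm b" if F: "finite F" for F
    proof -
      \<comment> \<open>Inserting zero keeps the maximum meaningful when \<open>F\<close> is empty.\<close>
      define K where "K = Max (insert 0 ((\<lambda>(m, n). m + n) ` F))"
      have "m + n \<le> K" if "(m, n) \<in> F" for m n
        unfolding K_def using F that by (intro Max_ge) force+
      then have "sum ?t F \<le> sum ?t {(m, n). m + n \<le> K}"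
        by (intro sum_mono2 finite_triangle) auto
      \<comment> \<open>In the double sum \<open>b\<close> carries the first index, so the two sequences change roles.\<close>
      also have "\<dots> = (\<Sum>(n, m)\<in>{(n, m). n + m \<le> K}. norm (b n) * norm (a m) / (real n + real m + 1))"
        by (intro sum.cong refl) (auto simp: mult_ac add_ac)
      also have "\<dots> \<le> \<bar>A\<bar> * ell2_norm b * ell2_norm a"
        by (rule hardy_imp_hilbert_partial[OF A ab(2,1)])
      finally show ?thesis by (simp add: mult_ac)
    qed
    have summ: "?t summable_on UNIV"
      by (rule nonneg_bdd_above_summable_on) (use fin in \<open>auto intro!: bdd_aboveI2\<close>)
    with fin show "?t summable_on UNIV \<and> infsum ?t UNIV \<le> \<bar>A\<bar> * ell2_norm a * ell2_norm b"
      by (intro conjI infsum_le_finite_sums) auto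
  qed
qed

section \<open>From Hilbert to Hardy\<close>

text \<open>The two squared moduli differ by \<open>(1 - (norm w)\<^sup>2) * (1 - (norm z)\<^sup>2)\<close>; their quotient
  belongs to a Blaschke factor.\<close>

lemma norm_diff_le_norm_reflected_factor:
  fixes z w :: complex
  assumes "norm w \<le> 1" "norm z \<le> 1"
  shows "norm (z - w) \<le> norm (1 - cnj w * z)"
    and "norm z = 1 \<Longrightarrow> norm (z - w) = norm (1 - cnj w * z)"
proof -
  have eq: "(norm (1 - cnj w * z))\<^sup>2 - (norm (z - w))\<^sup>2 = (1 - (norm w)\<^sup>2) * (1 - (norm z)\<^sup>2)"
  proof -
    have "(norm (1 - cnj w * z))\<^sup>2
        = (1 - (Re w * Re z + Im w * Im z))\<^sup>2 + (Im w * Re z - Re w * Im z)\<^sup>2"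
      unfolding cmod_power2 by simp
    then show ?thesis
      unfolding cmod_power2 minus_complex.sel by algebra
  qed
  have "0 \<le> (1 - (norm w)\<^sup>2) * (1 - (norm z)\<^sup>2)"
    using assms by (intro mult_nonneg_nonneg) (auto simp: power_le_one)
  with eq show "norm (z - w) \<le> norm (1 - cnj w * z)"
    by (intro power2_le_imp_le[OF _ norm_ge_zero]) linarith
  assume "norm z = 1"
  with eq have "(norm (z - w))\<^sup>2 = (norm (1 - cnj w * z))\<^sup>2"
    by simp
  then show "norm (z - w) = norm (1 - cnj w * z)"
    by (rule power2_eq_imp_eq) (rule norm_ge_zero)+
qed

text \<open>Induction on the degree, splitting off one linear factor \<open>z - w\<close> at a time. If \<open>w\<close> lies in
  the open disc, the factor is exchanged for \<open>1 - cnj w * z\<close>, which does not vanish in the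
  disc; otherwise it already has no zero in the open disc and is kept. In particular zeros on the
  unit circle are harmless.\<close>

lemma poly_reflect_zeros:
  fixes p :: "complex poly"
  assumes "p \<noteq> 0"
  shows "\<exists>q. (\<forall>z\<in>ball 0 1. poly q z \<noteq> 0) \<and> (\<forall>z\<in>cball 0 1. norm (poly p z) \<le> norm (poly q z))
    \<and> (\<forall>z\<in>sphere 0 1. norm (poly p z) = norm (poly q z))"
  using assms
proof (induction "degree p" arbitrary: p)
  case 0
  then obtain c where "p = [:c:]" "c \<noteq> 0"
    using degree_eq_zeroE[of p] by (metis pCons_0_0)
  then show ?case by (intro exI[of _ p]) auto
next
  case (Suc d)
  then obtain w where "poly p w = 0"
    using alg_closed_imp_poly_has_root[of p] by auto
  then obtain p' where p': "p = [:-w, 1:] * p'"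
    by (metis dvdE poly_eq_0_iff_dvd)
  with Suc.prems have "p' \<noteq> 0" by auto
  moreover have "degree p = Suc (degree p')"
    unfolding p' using \<open>p' \<noteq> 0\<close> by (subst degree_mult_eq) auto
  ultimately obtain q' where q': "\<forall>z\<in>ball 0 1. poly q' z \<noteq> 0"
      "\<forall>z\<in>cball 0 1. norm (poly p' z) \<le> norm (poly q' z)"
      "\<forall>z\<in>sphere 0 1. norm (poly p' z) = norm (poly q' z)"
    using Suc.hyps by (metis Suc_inject)
  define u where "u = (if norm w < 1 then [:1, - cnj w:] else [:-w, 1:])"
  have u: "poly u z = (if norm w < 1 then 1 - cnj w * z else z - w)" for z
    by (simp add: u_def algebra_simps)
  have "poly u z \<noteq> 0" if "norm z < 1" for z
  proof (cases "norm w < 1")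
    case True
    have "norm (cnj w * z) < 1"
      using mult_strict_mono'[OF True that] by (simp add: norm_mult)
    then show ?thesis using True by (auto simp: u)
  qed (use that in \<open>auto simp: u\<close>)
  moreover have "norm (z - w) \<le> norm (poly u z)" if "norm z \<le> 1" for z
    using norm_diff_le_norm_reflected_factor(1)[of w z] that by (simp add: u)
  moreover have "norm (z - w) = norm (poly u z)" if "norm z = 1" for z
    using norm_diff_le_norm_reflected_factor(2)[of w z] that by (simp add: u)
  moreover have "poly p z = (z - w) * poly p' z" for z
    by (simp add: p' algebra_simps)
  ultimately show ?case
    using q' by (intro exI[of _ "u * q'"]) (auto simp: norm_mult intro!: mult_mono)
qed

text \<open>Parseval's identity on circles of radius \<open>r < 1\<close> bounds each partial sum by the mean of
  \<open>q\<close>. Only this mean and the finite sum are carried to \<open>r = 1\<close>, so \<open>f\<close> needs no boundary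
  values.\<close>

lemma coeffs_ell2_of_square_le_poly:
  assumes sums: "\<And>z. z \<in> ball 0 1 \<Longrightarrow> (\<lambda>n. a n * z ^ n) sums f z"
    and le: "\<And>z. z \<in> ball 0 1 \<Longrightarrow> norm ((f z)\<^sup>2) \<le> norm (poly q z)"
  shows "a \<in> ell2" and "(ell2_norm a)\<^sup>2 \<le> circle_mean (poly q) 1"
proof -
  have bound: "(\<Sum>n<N. (norm (a n))\<^sup>2) \<le> circle_mean (poly q) 1" for N
  proof -
    have "(\<Sum>n<N. (norm (a n) * 1 ^ n)\<^sup>2) \<le> circle_mean (poly q) 1"
    proof (rule tendsto_le[OF trivial_limit_at_left_real circle_mean_tendsto])
      show "continuous_on UNIV (poly q)" by (intro continuous_intros)
      show "((\<lambda>r. \<Sum>n<N. (norm (a n) * r ^ n)\<^sup>2) \<longlongrightarrow> (\<Sum>n<N. (norm (a n) * 1 ^ n)\<^sup>2)) (at_left 1)"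
        by (intro tendsto_intros)
      have "(\<Sum>n<N. (norm (a n) * r ^ n)\<^sup>2) \<le> circle_mean (poly q) r" if r: "r \<in> {0<..<1}" for r
      proof -
        have par: "(\<lambda>n. (norm (a n) * r ^ n)\<^sup>2) sums circle_mean (\<lambda>z. (f z)\<^sup>2) r"
          by (rule parseval[OF sums]) (use r in auto)
        have "(\<Sum>n<N. (norm (a n) * r ^ n)\<^sup>2) \<le> circle_mean (\<lambda>z. (f z)\<^sup>2) r"
          unfolding sums_unique[OF par] by (rule sum_le_suminf[OF sums_summable[OF par]]) auto
        also have "\<dots> \<le> circle_mean (poly q) r"
          by (rule circle_mean_mono)
            (use r le power_series_continuous_on_sphere[OF sums, of r] in \<open>auto intro!: continuous_intros\<close>)
        finally show ?thesis .
      qed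
      then show "\<forall>\<^sub>F r in at_left 1. (\<Sum>n<N. (norm (a n) * r ^ n)\<^sup>2) \<le> circle_mean (poly q) r"
        by (rule eventually_mono[OF eventually_at_leftI[of 0]]) auto
    qed
    then show ?thesis by simp
  qed
  show "a \<in> ell2"
    unfolding ell2_def mem_Collect_eq
    by (rule bounded_imp_summable[of _ "circle_mean (poly q) 1"])
      (simp_all only: lessThan_Suc_atMost[symmetric] bound zero_le_power2)
  then show "(ell2_norm a)\<^sup>2 \<le> circle_mean (poly q) 1"
    unfolding ell2_norm_square[OF \<open>a \<in> ell2\<close>]
    by (intro suminf_le_const bound) (auto simp: ell2_def)
qed

text \<open>The coefficients of \<open>p = G * H\<close> are the Cauchy product of those of \<open>G\<close> and \<open>H\<close>. Hence the
  weighted sum of their moduli is dominated by a triangular part of the Hilbert double sum, and both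
  \<open>ell2\<close> norms are at most the square root of the mean of \<open>p\<close>.\<close>

lemma hilbert_imp_hardy_poly:
  assumes hilbert: "\<forall>a\<in>ell2. \<forall>b\<in>ell2.
        (\<lambda>(m, n). norm (a n) * norm (b m) / (real n + real m + 1)) summable_on UNIV \<and>
        (\<Sum>\<^sub>\<infinity>(m, n)\<in>UNIV. norm (a n) * norm (b m) / (real n + real m + 1))
          \<le> B * ell2_norm a * ell2_norm b"
  shows "(\<Sum>n\<le>K. norm (coeff p n) / (real n + 1)) \<le> \<bar>B\<bar> * circle_mean (poly p) 1"
proof (cases "p = 0")
  case True
  then show ?thesis by (simp add: circle_mean_nonneg)
next
  case False
  obtain q where q: "\<forall>z\<in>ball 0 1. poly q z \<noteq> 0"
      "\<forall>z\<in>cball 0 1. norm (poly p z) \<le> norm (poly q z)"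
      "\<forall>z\<in>sphere 0 1. norm (poly p z) = norm (poly q z)"
    using poly_reflect_zeros[OF False] by blast
  obtain G where G: "G holomorphic_on ball 0 1" "\<And>z. z \<in> ball 0 1 \<Longrightarrow> poly q z = (G z)\<^sup>2"
  proof (rule contractible_imp_holomorphic_sqrt)
    show "poly q holomorphic_on ball 0 1"
      by (intro holomorphic_intros)
    show "contractible (ball 0 1 :: complex set)"
      by (rule convex_imp_contractible) (rule convex_ball)
  qed (use q(1) in blast)+
  define H where "H z = poly p z / G z" for z
  have Gnz: "G z \<noteq> 0" if "z \<in> ball 0 1" for z
    using G(2) q(1) that by force
  have H: "H holomorphic_on ball 0 1"
    unfolding H_def by (intro holomorphic_intros G(1) Gnz)
  define g h where "g n = (deriv ^^ n) G 0 / fact n" and "h n = (deriv ^^ n) H 0 / fact n" for n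
  have g: "(\<lambda>n. g n * z ^ n) sums G z" and h: "(\<lambda>n. h n * z ^ n) sums H z" if "z \<in> ball 0 1" for z
    using holomorphic_power_series[OF G(1) that] holomorphic_power_series[OF H that]
    by (simp_all add: g_def h_def)
  have "coeff p = (\<lambda>k. \<Sum>i\<le>k. g i * h (k - i))"
  proof (rule power_series_coeffs_unique)
    fix z :: complex assume z: "z \<in> ball 0 1"
    have "(\<lambda>n. coeff p n * z ^ n) sums (\<Sum>n\<le>degree p. coeff p n * z ^ n)"
      by (rule sums_finite) (auto simp: coeff_eq_0)
    then show "(\<lambda>n. coeff p n * z ^ n) sums poly p z"
      by (simp add: poly_altdef)
    have "(\<lambda>k. \<Sum>i\<le>k. g i * z ^ i * (h (k - i) * z ^ (k - i)))
        sums ((\<Sum>n. g n * z ^ n) * (\<Sum>n. h n * z ^ n))"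
      by (rule Cauchy_product_sums)
        (use z summable_norm_power_series[OF g] summable_norm_power_series[OF h] in auto)
    also have "(\<Sum>n. g n * z ^ n) * (\<Sum>n. h n * z ^ n) = poly p z"
      unfolding sums_unique[OF g[OF z], symmetric] sums_unique[OF h[OF z], symmetric]
      using Gnz[OF z] by (simp add: H_def)
    also have "(\<lambda>k. \<Sum>i\<le>k. g i * z ^ i * (h (k - i) * z ^ (k - i)))
        = (\<lambda>k. (\<Sum>i\<le>k. g i * h (k - i)) * z ^ k)"
      unfolding sum_distrib_right
      by (intro ext sum.cong refl) (simp add: mult_ac flip: power_add)
    finally show "(\<lambda>k. (\<Sum>i\<le>k. g i * h (k - i)) * z ^ k) sums poly p z" .
  qed
  then have coeff: "coeff p k = (\<Sum>i\<le>k. g i * h (k - i))" for k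
    by simp
  have mean: "circle_mean (poly q) 1 = circle_mean (poly p) 1"
    by (rule circle_mean_cong) (use q(3) in auto)
  have "norm ((G z)\<^sup>2) \<le> norm (poly q z)" if "z \<in> ball 0 1" for z
    using G(2) that by simp
  note gb = coeffs_ell2_of_square_le_poly[OF g this]
  have "norm ((H z)\<^sup>2) \<le> norm (poly q z)" if z: "z \<in> ball 0 1" for z
  proof -
    have "norm ((H z)\<^sup>2) = (norm (poly p z))\<^sup>2 / norm (poly q z)"
      using G(2)[OF z] by (simp add: H_def power_divide norm_divide norm_power)
    also have "\<dots> \<le> (norm (poly q z))\<^sup>2 / norm (poly q z)"
      using q(2) z by (intro divide_right_mono power_mono) auto
    also have "\<dots> = norm (poly q z)"
      by (simp add: power2_eq_square)
    finally show ?thesis .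
  qed
  note hb = coeffs_ell2_of_square_le_poly[OF h this]
  let ?t = "\<lambda>(n, m). norm (h n) * norm (g m) / (real n + real m + 1)"
  have "(\<Sum>k\<le>K. norm (coeff p k) / (real k + 1))
      \<le> (\<Sum>k\<le>K. (\<Sum>i\<le>k. norm (g i) * norm (h (k - i))) / (real k + 1))"
    unfolding coeff by (intro sum_mono divide_right_mono sum_norm_le) (auto simp: norm_mult)
  also have "\<dots> = (\<Sum>(n, m)\<in>{(n, m). n + m \<le> K}. norm (g n) * norm (h m) / (real n + real m + 1))"
    by (rule hilbert_sum_triangle[symmetric])
  also have "\<dots> = (\<Sum>(m, n)\<in>{(m, n). m + n \<le> K}. norm (h n) * norm (g m) / (real n + real m + 1))"
    by (intro sum.cong refl) (auto simp: mult_ac add_ac)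
  also have "\<dots> \<le> (\<Sum>\<^sub>\<infinity>(m, n)\<in>UNIV. norm (h n) * norm (g m) / (real n + real m + 1))"
    using hilbert hb(1) gb(1) by (intro finite_sum_le_infsum finite_triangle) auto
  also have "\<dots> \<le> B * ell2_norm h * ell2_norm g"
    using hilbert hb(1) gb(1) by blast
  also have "\<dots> \<le> \<bar>B\<bar> * (ell2_norm h * ell2_norm g)"
    using hb(1) gb(1) by (simp add: mult.assoc mult_right_mono ell2_norm_nonneg)
  also have "\<dots> \<le> \<bar>B\<bar> * circle_mean (poly p) 1"
    using sum_squares_bound[of "ell2_norm h" "ell2_norm g"] hb(2) gb(2) mean
    by (intro mult_left_mono) auto
  finally show ?thesis .
qed

text \<open>For fixed \<open>r < 1\<close> and \<open>K\<close>, the polynomial case is applied to the Taylor polynomials of the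
  dilated function \<open>f (r * z)\<close>. The error made in the mean is at most the tail \<open>T N\<close> of an
  absolutely convergent series. Letting first \<open>N\<close> tend to infinity, then \<open>r\<close> to one, and only
  then \<open>K\<close> to infinity gives both convergence and the bound.\<close>

lemma hilbert_imp_hardy:
  assumes "hilbert_inequality"
  shows "hardy_inequality"
proof -
  from assms obtain B where B: "\<forall>a\<in>ell2. \<forall>b\<in>ell2.
        (\<lambda>(m, n). norm (a n) * norm (b m) / (real n + real m + 1)) summable_on UNIV \<and>
        (\<Sum>\<^sub>\<infinity>(m, n)\<in>UNIV. norm (a n) * norm (b m) / (real n + real m + 1))
          \<le> B * ell2_norm a * ell2_norm b"
    unfolding hilbert_inequality_def by blast
  show ?thesis
    unfolding hardy_inequality_def
  proof (intro exI[of _ "\<bar>B\<bar>"] ballI allI impI)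
    fix f :: "complex \<Rightarrow> complex" and a :: "nat \<Rightarrow> complex"
    assume f: "f \<in> hardy_H1" and "\<forall>z\<in>ball 0 1. (\<lambda>n. a n * z ^ n) sums f z"
    then have sums: "(\<lambda>n. a n * z ^ n) sums f z" if "z \<in> ball 0 1" for z
      using that by blast
    have dilated: "(\<Sum>n\<le>K. norm (a n) * r ^ n / (real n + 1)) \<le> \<bar>B\<bar> * hardy_norm1 f"
      if r: "r \<in> {0<..<1}" for r K
    proof -
      define c where "c n = a n * of_real r ^ n" for n
      have c: "norm (c n) = norm (a n) * r ^ n" for n
        using r by (simp add: c_def norm_mult norm_power)
      have summ: "summable (\<lambda>n. norm (c n))"
        unfolding c_def by (rule summable_norm_power_series[OF sums]) (use r in auto)
      define T where "T N = (\<Sum>n. norm (c (n + N)))" for N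
      have "(\<Sum>n\<le>K. norm (a n) * r ^ n / (real n + 1)) \<le> \<bar>B\<bar> * (circle_mean f r + T N)" if "K < N" for N
      proof -
        define p where "p = (\<Sum>n<N. monom (c n) n)"
        have p: "poly p z = (\<Sum>n<N. c n * z ^ n)" for z
          by (simp add: p_def poly_sum poly_monom)
        have "coeff p n = c n" if "n \<le> K" for n
          using that \<open>K < N\<close> by (simp add: p_def coeff_sum)
        then have "(\<Sum>n\<le>K. norm (a n) * r ^ n / (real n + 1)) = (\<Sum>n\<le>K. norm (coeff p n) / (real n + 1))"
          by (simp add: c)
        also have "\<dots> \<le> \<bar>B\<bar> * circle_mean (poly p) 1"
          by (rule hilbert_imp_hardy_poly[OF B])
        also have "circle_mean (poly p) 1 = circle_mean (\<lambda>z. \<Sum>n<N. a n * z ^ n) r"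
          by (simp add: circle_mean_def p c_def power_mult_distrib mult_ac)
        also have "\<dots> \<le> 1 * circle_mean f r + T N * circle_mean (\<lambda>_. 1) r"
        proof (rule circle_mean_le_combination)
          fix z :: complex assume z: "z \<in> sphere 0 r"
          then have sz: "(\<lambda>n. a n * z ^ n) sums f z"
            using r by (intro sums) auto
          have eq: "norm (a n * z ^ n) = norm (c n)" for n
            using z by (simp add: c norm_mult norm_power)
          have "f z - (\<Sum>n<N. a n * z ^ n) = (\<Sum>n. a (n + N) * z ^ (n + N))"
            using suminf_minus_initial_segment[OF sums_summable[OF sz], of N] sums_unique[OF sz] by simp
          also have "norm \<dots> \<le> T N"
            unfolding T_def eq[symmetric]
            by (rule summable_norm)
              (use summable_ignore_initial_segment[OF summ, of N] in \<open>simp only: eq\<close>)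
          finally have "norm (f z - (\<Sum>n<N. a n * z ^ n)) \<le> T N" .
          then show "norm (\<Sum>n<N. a n * z ^ n) \<le> 1 * norm (f z) + T N * norm (1::complex)"
            using norm_triangle_ineq3[of "\<Sum>n<N. a n * z ^ n" "f z"] by (simp add: norm_minus_commute)
        qed (use r power_series_continuous_on_sphere[OF sums, of r] in \<open>auto intro!: continuous_intros\<close>)
        finally show ?thesis
          by (simp add: circle_mean_one mult_left_mono)
      qed
      then have ev: "\<forall>\<^sub>F N in sequentially.
          (\<Sum>n\<le>K. norm (a n) * r ^ n / (real n + 1)) \<le> \<bar>B\<bar> * (circle_mean f r + T N)"
        by (intro eventually_mono[OF eventually_gt_at_top[of K]])
      have "T \<longlonglongrightarrow> 0"
        unfolding T_def by (rule suminf_exist_split2[OF summ])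
      then have "(\<lambda>N. \<bar>B\<bar> * (circle_mean f r + T N)) \<longlonglongrightarrow> \<bar>B\<bar> * (circle_mean f r + 0)"
        by (intro tendsto_intros)
      from tendsto_lowerbound[OF this ev sequentially_bot]
      have "(\<Sum>n\<le>K. norm (a n) * r ^ n / (real n + 1)) \<le> \<bar>B\<bar> * circle_mean f r"
        by simp
      also have "\<dots> \<le> \<bar>B\<bar> * hardy_norm1 f"
        unfolding hardy_norm1_def using f r
        by (intro mult_left_mono cSUP_upper) (auto simp: hardy_H1_def)
      finally show ?thesis .
    qed
    have bound: "(\<Sum>n\<le>K. norm (a n) / (real n + 1)) \<le> \<bar>B\<bar> * hardy_norm1 f" for K
    proof -
      have "(\<Sum>n\<le>K. norm (a n) * 1 ^ n / (real n + 1)) \<le> \<bar>B\<bar> * hardy_norm1 f"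
      proof (rule tendsto_upperbound)
        show "((\<lambda>r. \<Sum>n\<le>K. norm (a n) * r ^ n / (real n + 1))
            \<longlongrightarrow> (\<Sum>n\<le>K. norm (a n) * 1 ^ n / (real n + 1))) (at_left (1::real))"
          by (intro tendsto_intros) auto
        show "\<forall>\<^sub>F r in at_left 1. (\<Sum>n\<le>K. norm (a n) * r ^ n / (real n + 1)) \<le> \<bar>B\<bar> * hardy_norm1 f"
          by (rule eventually_mono[OF eventually_at_leftI[of 0]]) (use dilated in auto)
      qed simp
      then show ?thesis by simp
    qed
    have "summable (\<lambda>n. norm (a n) / (real n + 1))"
      by (rule bounded_imp_summable[OF _ bound]) auto
    moreover from this have "(\<Sum>n. norm (a n) / (real n + 1)) \<le> \<bar>B\<bar> * hardy_norm1 f"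
    proof (rule suminf_le_const)
      fix K
      have "(\<Sum>n<K. norm (a n) / (real n + 1)) \<le> (\<Sum>n\<le>K. norm (a n) / (real n + 1))"
        by (rule sum_mono2) auto
      also note bound
      finally show "(\<Sum>n<K. norm (a n) / (real n + 1)) \<le> \<bar>B\<bar> * hardy_norm1 f" .
    qed
    ultimately show "summable (\<lambda>n. norm (a n) / (real n + 1)) \<and>
          (\<Sum>n. norm (a n) / (real n + 1)) \<le> \<bar>B\<bar> * hardy_norm1 f" ..
  qed
qed

theorem corollary3p6:
  shows "hardy_inequality \<longleftrightarrow> hilbert_inequality"
  using hardy_imp_hilbert hilbert_imp_hardy by blast

end
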